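(* For positive integers $m\ge n$, the algebra $\mathcal{T}_{n,m}$ is quadratic.
   Context: Let $\mathbb{K}$ be an algebraically closed field of characteristic zero. A semistandard Young tableau of partition shape $\lambda$ is a filling of the Ferrers diagram of $\lambda$ (English notation) with positive integers, strictly increasing down columns and weakly increasing from left to right along rows. For positive integers $m\ge n$, $\mathrm{SSYT}_m^n$ denotes the set of all semistandard Young tableaux of all partition shapes with at most $n$ rows and with entries in $\{1,\dots,m\}$ (including the empty tableau $\emptyset$). For $T$ of shape $\lambda$ and $T'$ of shape $\mu$, $T\star T'$ is the semistandard Young tableau of shape $\lambda+\mu$ obtained by horizontally concatenating the rows of $T$ and $T'$ and sorting the entries in each row in weakly increasing order. $(\mathrm{SSYT}_m^n,\star,\emptyset)$ is a commutative monoid, and the tableaux algebra $\mathcal{T}_{n,m}$ is its monoid algebra over $\mathbb{K}$. Let $G_{n,m}$ be the set of tableaux in $\mathrm{SSYT}_m^n$ with exactly one column (of height $1,\dots,n$) and $V_{n,m}$ the $\mathbb{K}$-vector space with basis $G_{n,m}$; $G_{n,m}$ generates $\mathcal{T}_{n,m}$. A $\mathbb{K}$-algebra $A$ is quadratic when it is finitely generated and all its relations are homogeneous of degree two, i.e. $A$ is of the form $T(V)/\langle R\rangle$ with $V$ a (finite-dimensional) vector space, $T(V)$ its tensor algebra and $R\subseteq V\otimes V$. Here the presentation is the one with $V=V_{n,m}$. *)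

theory Defs
  imports
    "HOL-Computational_Algebra.Polynomial"
    "HOL-Library.Poly_Mapping"
    "HOL-Algebra.QuotRing"
    "HOL-Algebra.Module"
begin

section \<open>Semistandard Young tableaux\<close>

text \<open>
  A filling is given by the list of its rows, from top to bottom.  Partitions have no zero
  parts, so a tableau has no empty rows and the empty tableau is the empty list.
\<close>

definition shape :: "nat list list \<Rightarrow> nat list" where
  "shape T = map length T"

definition is_partition :: "nat list \<Rightarrow> bool" where
  "is_partition p \<longleftrightarrow> sorted_wrt (\<ge>) p \<and> 0 \<notin> set p"

definition is_ssyt :: "nat list list \<Rightarrow> bool" where
  "is_ssyt T \<longleftrightarrow>
     is_partition (shape T) \<and>
     (\<forall>r\<in>set T. sorted r \<and> 0 \<notin> set r) \<and>
     (\<forall>i j. Suc i < length T \<and> j < length (T ! Suc i) \<longrightarrow> T ! i ! j < T ! Suc i ! j)"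

definition SSYT :: "nat \<Rightarrow> nat \<Rightarrow> nat list list set" where
  "SSYT n m = {T. is_ssyt T \<and> length T \<le> n \<and> (\<forall>r\<in>set T. set r \<subseteq> {1..m})}"

definition row :: "nat list list \<Rightarrow> nat \<Rightarrow> nat list" where
  "row T i = (if i < length T then T ! i else [])"

definition star :: "nat list list \<Rightarrow> nat list list \<Rightarrow> nat list list"  (infixl \<open>\<star>\<close> 70) where
  "T \<star> T' = map (\<lambda>i. sort (row T i @ row T' i)) [0..<max (length T) (length T')]"

definition ssyt_monoid :: "nat \<Rightarrow> nat \<Rightarrow> nat list list monoid" where
  "ssyt_monoid n m = \<lparr>carrier = SSYT n m, mult = (\<star>), one = []\<rparr>"

definition num_columns :: "nat list list \<Rightarrow> nat" where
  "num_columns T = (if T = [] then 0 else length (hd T))"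

definition one_column_tableaux :: "nat \<Rightarrow> nat \<Rightarrow> nat list list set" where
  "one_column_tableaux n m = {T \<in> SSYT n m. num_columns T = 1}"


section \<open>Monoid algebras\<close>

text \<open>
  An algebra over the field \<open>'k\<close> is a \<open>module\<close> record with scalars in \<open>'k\<close>.  (The library's
  locale \<open>algebra\<close> covers commutative algebras only.)  The monoid algebra consists of the
  finitely supported functions on the carrier of the monoid, multiplied by bilinear extension
  of the monoid operation.
\<close>

definition monoid_algebra :: "('a, 'b) monoid_scheme \<Rightarrow> ('k::field, 'a \<Rightarrow>\<^sub>0 'k) module" where
  "monoid_algebra M =
     \<lparr>carrier = {f. Poly_Mapping.keys f \<subseteq> carrier M},
      mult = (\<lambda>f g. \<Sum>x\<in>Poly_Mapping.keys f. \<Sum>y\<in>Poly_Mapping.keys g.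
                Poly_Mapping.single (x \<otimes>\<^bsub>M\<^esub> y) (Poly_Mapping.lookup f x * Poly_Mapping.lookup g y)),
      one = Poly_Mapping.single \<one>\<^bsub>M\<^esub> 1,
      zero = 0,
      add = (+),
      smult = (\<lambda>c f. Poly_Mapping.map ((*) c) f)\<rparr>"

definition tableaux_algebra :: "nat \<Rightarrow> nat \<Rightarrow> ('k::field, nat list list \<Rightarrow>\<^sub>0 'k) module" where
  "tableaux_algebra n m = monoid_algebra (ssyt_monoid n m)"


section \<open>Tensor algebras and quadratic algebras\<close>

text \<open>
  For the vector space \<open>V\<close> with basis \<open>G\<close>, the tensor power of degree \<open>k\<close> of \<open>V\<close> has as basis the
  words of length \<open>k\<close> over \<open>G\<close>, the word \<open>[g\<^sub>1, \<dots>, g\<^sub>k]\<close> standing for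
  \<open>g\<^sub>1 \<otimes> \<dots> \<otimes> g\<^sub>k\<close>; the product of the tensor algebra is concatenation.
\<close>

definition word_monoid :: "'g set \<Rightarrow> 'g list monoid" where
  "word_monoid G = \<lparr>carrier = lists G, mult = (@), one = []\<rparr>"

definition tensor_algebra :: "'g set \<Rightarrow> ('k::field, 'g list \<Rightarrow>\<^sub>0 'k) module" where
  "tensor_algebra G = monoid_algebra (word_monoid G)"

definition tensor_power :: "'g set \<Rightarrow> nat \<Rightarrow> ('g list \<Rightarrow>\<^sub>0 'k::field) set" where
  "tensor_power G k =
     {f \<in> carrier (tensor_algebra G). \<forall>w\<in>Poly_Mapping.keys f. length w = k}"

text \<open>The quotient ring by \<open>I\<close>, with the scalar multiplication \<open>c (I + x) = I + c x\<close>.\<close>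

definition quotient_algebra :: "('k, 'a) module \<Rightarrow> 'a set \<Rightarrow> ('k, 'a set) module" where
  "quotient_algebra A I =
     ring.extend (A Quot I)
       (module.fields (\<lambda>c C. \<Union>x\<in>C. I +>\<^bsub>A\<^esub> (c \<odot>\<^bsub>A\<^esub> x)))"

definition algebra_iso :: "('k, 'a) module \<Rightarrow> ('k, 'b) module \<Rightarrow> ('a \<Rightarrow> 'b) set" where
  "algebra_iso A B =
     {h \<in> ring_iso A B. \<forall>c. \<forall>x\<in>carrier A. h (c \<odot>\<^bsub>A\<^esub> x) = c \<odot>\<^bsub>B\<^esub> h x}"

text \<open>
  \<open>A\<close> is quadratic with respect to the presentation in which \<open>V\<close> has basis \<open>G\<close> and the basis
  vector \<open>g\<close> is sent to \<open>\<iota> g\<close>: for some set \<open>R\<close> of tensors of degree two, \<open>A\<close> is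
  the quotient of the tensor algebra by the two-sided ideal generated by \<open>R\<close>, the class of
  each \<open>g\<close> being identified with \<open>\<iota> g\<close>.
\<close>

definition quadratic_presentation ::
    "('k::field, 'a) module \<Rightarrow> 'g set \<Rightarrow> ('g \<Rightarrow> 'a) \<Rightarrow> bool" where
  "quadratic_presentation A G \<iota> \<longleftrightarrow>
     finite G \<and>
     (\<exists>R :: ('g list \<Rightarrow>\<^sub>0 'k) set. R \<subseteq> tensor_power G 2 \<and>
        (let T = tensor_algebra G; I = Idl\<^bsub>T\<^esub> R in
         \<exists>h \<in> algebra_iso (quotient_algebra T I) A.
           \<forall>g\<in>G. h (I +>\<^bsub>T\<^esub> Poly_Mapping.single [g] 1) = \<iota> g))"

end

theory Submission
  imports Defs "HOL-Library.Extended_Nat" "HOL-Library.Multiset"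
begin

text \<open>
  Both the tensor algebra on the span of the columns and the tableaux algebra are monoid algebras, of
  the monoid of words in the columns and of the monoid of tableaux.  The presentation is the linear
  extension of the map that multiplies out a word.  The kernel of such an extension is spanned by
  the differences of words with the same product (\<open>push_forward_kernel\<close>).  It is therefore generated
  in degree two as soon as any two words with the same product are connected by moves, each of which
  replaces two adjacent letters by two letters with the same product
  (\<open>quadratic_presentation_of_connected_words\<close>).

  To connect words of columns, pad the columns with infinity to a common height.  Componentwise
  minimum and maximum then make them a lattice, and the meet and join of two columns have the
  same product as the two columns themselves (\<open>column_meet_star_join\<close>).  Replacing adjacent columns by
  their meet and join is bubble sort in all rows at once.  So every word is connected to a
  straightened word, whose rows are the sorted lists of the padded entries in the rows of the original
  word (\<open>map_entry_straighten\<close>).  The product of a word determines these multisets of entries: it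
  shows all finite entries, and the length of its first row is the number of columns, hence also
  gives the number of infinite entries in each row.  Words with the same product thus have the same
  straightened word (\<open>straighten_eq\<close>), through which they are connected.
\<close>

section \<open>Linear extension of a map of bases\<close>

lemma poly_mapping_eq_sum_singles:
  fixes f :: "'a \<Rightarrow>\<^sub>0 'k::comm_monoid_add"
  shows "f = (\<Sum>x\<in>Poly_Mapping.keys f. Poly_Mapping.single x (Poly_Mapping.lookup f x))"
proof (rule poly_mapping_eqI)
  fix k
  show "Poly_Mapping.lookup f k = Poly_Mapping.lookup
    (\<Sum>x\<in>Poly_Mapping.keys f. Poly_Mapping.single x (Poly_Mapping.lookup f x)) k"
    by (cases "k \<in> Poly_Mapping.keys f")
       (auto simp: lookup_sum lookup_single when_def in_keys_iff)
qed

lemma keys_add_subset: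
  assumes "Poly_Mapping.keys f \<subseteq> S" "Poly_Mapping.keys g \<subseteq> S"
  shows "Poly_Mapping.keys (f + g) \<subseteq> S"
  using Poly_Mapping.keys_add[of f g] assms by blast

text \<open>
  Additive identities in a monoid algebra need only be checked on basis elements, but those identities
  that rest on the monoid laws hold only for basis elements of the carrier; so the induction keeps
  track of the support.
\<close>

lemma poly_mapping_keys_induct [consumes 1, case_names zero single add]:
  fixes f :: "'a \<Rightarrow>\<^sub>0 'k::comm_monoid_add"
  assumes "Poly_Mapping.keys f \<subseteq> S"
    and zero: "P 0"
    and single: "\<And>x c. x \<in> S \<Longrightarrow> P (Poly_Mapping.single x c)"
    and add: "\<And>f g. Poly_Mapping.keys f \<subseteq> S \<Longrightarrow> Poly_Mapping.keys g \<subseteq> S \<Longrightarrow> P f \<Longrightarrow> P g \<Longrightarrow> P (f + g)"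
  shows "P f"
proof -
  have "Poly_Mapping.keys (\<Sum>x\<in>X. Poly_Mapping.single x (Poly_Mapping.lookup f x)) \<subseteq> S \<and>
      P (\<Sum>x\<in>X. Poly_Mapping.single x (Poly_Mapping.lookup f x))"
    if "finite X" "X \<subseteq> S" for X
    using that
  proof (induction X)
    case (insert x X)
    moreover have "Poly_Mapping.keys (Poly_Mapping.single x (Poly_Mapping.lookup f x)) \<subseteq> S"
      using insert.prems by auto
    ultimately show ?case
      by (simp add: add single keys_add_subset)
  qed (simp add: zero)
  then show ?thesis
    using assms(1) poly_mapping_eq_sum_singles[of f] by (metis finite_keys)
qed

text \<open>
  The linear extension of \<open>p\<close> to the free vector spaces on its source and target.
\<close>

definition push_forward :: "('a \<Rightarrow> 'b) \<Rightarrow> ('a \<Rightarrow>\<^sub>0 'k::comm_monoid_add) \<Rightarrow> ('b \<Rightarrow>\<^sub>0 'k)" where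
  "push_forward p f =
     (\<Sum>x\<in>Poly_Mapping.keys f. Poly_Mapping.single (p x) (Poly_Mapping.lookup f x))"

text \<open>
  The support of a sum depends on cancellation.  A summation range that may be any finite superset of
  the support is what makes additivity a matter of distributing sums.
\<close>

lemma push_forward_superset:
  assumes "finite X" "Poly_Mapping.keys f \<subseteq> X"
  shows "push_forward p f = (\<Sum>x\<in>X. Poly_Mapping.single (p x) (Poly_Mapping.lookup f x))"
  unfolding push_forward_def
  by (rule sum.mono_neutral_left) (use assms in \<open>auto simp: in_keys_iff\<close>)

lemma push_forward_zero [simp]: "push_forward p 0 = 0"
  by (simp add: push_forward_def)

lemma push_forward_single [simp]:
  "push_forward p (Poly_Mapping.single x c) = Poly_Mapping.single (p x) c"
  by (subst push_forward_superset[of "{x}"]) auto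

lemma push_forward_add:
  "push_forward p (f + g) = push_forward p f + push_forward p g"
proof -
  let ?X = "Poly_Mapping.keys f \<union> Poly_Mapping.keys g"
  have "Poly_Mapping.keys (f + g) \<subseteq> ?X"
    by (rule Poly_Mapping.keys_add)
  then show ?thesis
    by (simp add: push_forward_superset[of ?X] lookup_add single_add sum.distrib)
qed

lemma push_forward_diff:
  fixes f g :: "'a \<Rightarrow>\<^sub>0 'k::ab_group_add"
  shows "push_forward p (f - g) = push_forward p f - push_forward p g"
  using push_forward_add[of p "f - g" g] by simp

lemma keys_scale_subset:
  fixes c :: "'k::field"
  shows "Poly_Mapping.keys (Poly_Mapping.map ((*) c) f) \<subseteq> Poly_Mapping.keys f"
  by (auto simp: in_keys_iff Poly_Mapping.map.rep_eq)

lemma push_forward_scale: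
  fixes c :: "'k::field"
  shows "push_forward p (Poly_Mapping.map ((*) c) f) = Poly_Mapping.map ((*) c) (push_forward p f)"
proof -
  have add: "Poly_Mapping.map ((*) c) (g + h) = Poly_Mapping.map ((*) c) g + Poly_Mapping.map ((*) c) h"
    for g h :: "'d \<Rightarrow>\<^sub>0 'k"
    by (rule poly_mapping_eqI) (simp add: Poly_Mapping.map.rep_eq lookup_add when_def flip: distrib_left)
  have single: "Poly_Mapping.map ((*) c) (Poly_Mapping.single x d) = Poly_Mapping.single x (c * d)"
    for x :: 'd and d
    by (rule poly_mapping_eqI) (simp add: Poly_Mapping.map.rep_eq lookup_single when_def)
  have zero: "Poly_Mapping.map ((*) c) 0 = (0 :: 'd \<Rightarrow>\<^sub>0 'k)"
    by (rule poly_mapping_eqI) (simp add: Poly_Mapping.map.rep_eq)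
  have "Poly_Mapping.keys f \<subseteq> UNIV" by simp
  then show ?thesis
    by (induction rule: poly_mapping_keys_induct)
       (simp_all add: zero single add push_forward_add)
qed

lemma push_forward_push_forward: "push_forward p (push_forward q f) = push_forward (\<lambda>x. p (q x)) f"
proof -
  have "Poly_Mapping.keys f \<subseteq> UNIV" by simp
  then show ?thesis
    by (induction rule: poly_mapping_keys_induct) (simp_all add: push_forward_add)
qed

lemma push_forward_ident:
  assumes "\<And>x. x \<in> Poly_Mapping.keys f \<Longrightarrow> p x = x"
  shows "push_forward p f = f"
  using poly_mapping_eq_sum_singles[of f] assms by (simp add: push_forward_def)

lemma keys_push_forward: "Poly_Mapping.keys (push_forward p f) \<subseteq> p ` Poly_Mapping.keys f"
  unfolding push_forward_def using keys_sum[of _ "Poly_Mapping.keys f"]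
  by (fastforce split: if_splits)

section \<open>The monoid algebra is a ring\<close>

lemma monoid_algebra_simps:
  "carrier (monoid_algebra M) = {f. Poly_Mapping.keys f \<subseteq> carrier M}"
  "one (monoid_algebra M) = Poly_Mapping.single \<one>\<^bsub>M\<^esub> 1"
  "zero (monoid_algebra M) = 0"
  "add (monoid_algebra M) = (+)"
  "smult (monoid_algebra M) = (\<lambda>c f. Poly_Mapping.map ((*) c) f)"
  by (simp_all add: monoid_algebra_def)

text \<open>
  As for the linear extension, a common summation range for several factors turns both distributive
  laws into rearrangements of sums.
\<close>

lemma monoid_algebra_mult_superset:
  assumes "finite X" "Poly_Mapping.keys f \<subseteq> X" "finite Y" "Poly_Mapping.keys g \<subseteq> Y"
  shows "f \<otimes>\<^bsub>monoid_algebra M\<^esub> g = (\<Sum>x\<in>X. \<Sum>y\<in>Y.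
    Poly_Mapping.single (x \<otimes>\<^bsub>M\<^esub> y) (Poly_Mapping.lookup f x * Poly_Mapping.lookup g y))"
proof -
  have "f \<otimes>\<^bsub>monoid_algebra M\<^esub> g = (\<Sum>x\<in>X. \<Sum>y\<in>Poly_Mapping.keys g.
    Poly_Mapping.single (x \<otimes>\<^bsub>M\<^esub> y) (Poly_Mapping.lookup f x * Poly_Mapping.lookup g y))"
    unfolding monoid_algebra_def by simp
      (rule sum.mono_neutral_left, use assms in \<open>auto simp: in_keys_iff\<close>)
  also have "\<dots> = (\<Sum>x\<in>X. \<Sum>y\<in>Y.
    Poly_Mapping.single (x \<otimes>\<^bsub>M\<^esub> y) (Poly_Mapping.lookup f x * Poly_Mapping.lookup g y))"
    by (intro sum.cong refl sum.mono_neutral_left) (use assms in \<open>auto simp: in_keys_iff\<close>)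
  finally show ?thesis .
qed

lemma monoid_algebra_mult_add_left:
  "(f + f') \<otimes>\<^bsub>monoid_algebra M\<^esub> g
     = f \<otimes>\<^bsub>monoid_algebra M\<^esub> g + f' \<otimes>\<^bsub>monoid_algebra M\<^esub> g"
proof -
  let ?X = "Poly_Mapping.keys f \<union> Poly_Mapping.keys f'"
  have "Poly_Mapping.keys (f + f') \<subseteq> ?X"
    by (rule Poly_Mapping.keys_add)
  then show ?thesis
    by (simp add: monoid_algebra_mult_superset[of ?X _ "Poly_Mapping.keys g"]
        lookup_add distrib_right single_add sum.distrib)
qed

lemma monoid_algebra_mult_add_right:
  "g \<otimes>\<^bsub>monoid_algebra M\<^esub> (f + f')
     = g \<otimes>\<^bsub>monoid_algebra M\<^esub> f + g \<otimes>\<^bsub>monoid_algebra M\<^esub> f'"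
proof -
  let ?X = "Poly_Mapping.keys f \<union> Poly_Mapping.keys f'"
  have "Poly_Mapping.keys (f + f') \<subseteq> ?X"
    by (rule Poly_Mapping.keys_add)
  then show ?thesis
    by (simp add: monoid_algebra_mult_superset[of "Poly_Mapping.keys g" _ ?X]
        lookup_add distrib_left single_add sum.distrib)
qed

lemma monoid_algebra_mult_zero [simp]:
  "0 \<otimes>\<^bsub>monoid_algebra M\<^esub> g = 0" "g \<otimes>\<^bsub>monoid_algebra M\<^esub> 0 = 0"
  by (simp_all add: monoid_algebra_def)

lemma monoid_algebra_mult_single [simp]:
  "Poly_Mapping.single x a \<otimes>\<^bsub>monoid_algebra M\<^esub> Poly_Mapping.single y b
     = Poly_Mapping.single (x \<otimes>\<^bsub>M\<^esub> y) (a * b)"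
  by (subst monoid_algebra_mult_superset[of "{x}" _ "{y}"]) auto

lemma keys_monoid_algebra_mult:
  assumes "monoid M" "Poly_Mapping.keys f \<subseteq> carrier M" "Poly_Mapping.keys g \<subseteq> carrier M"
  shows "Poly_Mapping.keys (f \<otimes>\<^bsub>monoid_algebra M\<^esub> g) \<subseteq> carrier M"
proof -
  interpret monoid M by fact
  show ?thesis
    using assms(2)
  proof (induction rule: poly_mapping_keys_induct)
    case (single x c)
    show ?case
      using assms(3)
    proof (induction rule: poly_mapping_keys_induct)
      case (add f g)
      then show ?case
        unfolding monoid_algebra_mult_add_right by (intro keys_add_subset)
    qed (use single in auto)
  next
    case (add f g)
    then show ?case
      unfolding monoid_algebra_mult_add_left by (intro keys_add_subset)
  qed auto
qed

lemma monoid_algebra_mult_assoc: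
  assumes "monoid M" "Poly_Mapping.keys f \<subseteq> carrier M" "Poly_Mapping.keys g \<subseteq> carrier M"
    "Poly_Mapping.keys h \<subseteq> carrier M"
  shows "(f \<otimes>\<^bsub>monoid_algebra M\<^esub> g) \<otimes>\<^bsub>monoid_algebra M\<^esub> h
     = f \<otimes>\<^bsub>monoid_algebra M\<^esub> (g \<otimes>\<^bsub>monoid_algebra M\<^esub> h)"
proof -
  interpret monoid M by fact
  show ?thesis
    using assms(2)
  proof (induction rule: poly_mapping_keys_induct)
    case (single x c)
    note x = single
    show ?case
      using assms(3)
    proof (induction rule: poly_mapping_keys_induct)
      case (single y d)
      show ?case
        using assms(4)
        by (induction rule: poly_mapping_keys_induct)
           (use x single in \<open>simp_all add: monoid_algebra_mult_add_right m_assoc mult.assoc\<close>)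
    qed (simp_all add: monoid_algebra_mult_add_right monoid_algebra_mult_add_left)
  qed (simp_all add: monoid_algebra_mult_add_left)
qed

text \<open>
  Both sides of each ring law are additive in every argument, which reduces it to the corresponding
  law for monoid elements.
\<close>

lemma monoid_algebra_ring:
  fixes M :: "('a, 'b) monoid_scheme"
  assumes "monoid M"
  shows "ring (monoid_algebra M :: ('k::field, 'a \<Rightarrow>\<^sub>0 'k) module)"
proof -
  interpret monoid M by fact
  let ?A = "monoid_algebra M :: ('k, 'a \<Rightarrow>\<^sub>0 'k) module"
  have one_left: "\<one>\<^bsub>?A\<^esub> \<otimes>\<^bsub>?A\<^esub> f = f" and one_right: "f \<otimes>\<^bsub>?A\<^esub> \<one>\<^bsub>?A\<^esub> = f"
    if "Poly_Mapping.keys f \<subseteq> carrier M" for f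
    using that
    by (induction rule: poly_mapping_keys_induct)
       (simp_all add: monoid_algebra_simps monoid_algebra_mult_add_right monoid_algebra_mult_add_left)
  show ?thesis
  proof (rule ringI)
    show "abelian_group ?A"
    proof (rule abelian_groupI)
      fix f assume f: "f \<in> carrier ?A"
      show "\<exists>g\<in>carrier ?A. g \<oplus>\<^bsub>?A\<^esub> f = \<zero>\<^bsub>?A\<^esub>"
        by (rule bexI[of _ "- f"]) (use f in \<open>simp_all add: monoid_algebra_simps\<close>)
    qed (simp_all add: monoid_algebra_simps keys_add_subset add_ac)
    show "monoid ?A"
    proof (rule monoidI)
      show "f \<otimes>\<^bsub>?A\<^esub> g \<in> carrier ?A" if "f \<in> carrier ?A" "g \<in> carrier ?A" for f g
        using that keys_monoid_algebra_mult[OF assms] by (simp add: monoid_algebra_simps(1))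
      show "(f \<otimes>\<^bsub>?A\<^esub> g) \<otimes>\<^bsub>?A\<^esub> h = f \<otimes>\<^bsub>?A\<^esub> (g \<otimes>\<^bsub>?A\<^esub> h)"
        if "f \<in> carrier ?A" "g \<in> carrier ?A" "h \<in> carrier ?A" for f g h
        using that monoid_algebra_mult_assoc[OF assms] by (simp add: monoid_algebra_simps(1))
    qed (use one_left one_right in \<open>auto simp: monoid_algebra_simps(1,2)\<close>)
  qed (auto simp: monoid_algebra_simps(4) monoid_algebra_mult_add_left monoid_algebra_mult_add_right)
qed

section \<open>The kernel of a map of monoid algebras\<close>

lemma push_forward_ring_hom:
  fixes M :: "('a, 'b) monoid_scheme" and N :: "('c, 'd) monoid_scheme"
  assumes M: "monoid M" and N: "monoid N" and p: "p \<in> hom M N" "p \<one>\<^bsub>M\<^esub> = \<one>\<^bsub>N\<^esub>"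
  shows "ring_hom_ring (monoid_algebra M :: ('k::field, 'a \<Rightarrow>\<^sub>0 'k) module) (monoid_algebra N)
    (push_forward p)"
proof (rule ring_hom_ringI)
  let ?A = "monoid_algebra M :: ('k, 'a \<Rightarrow>\<^sub>0 'k) module"
  let ?B = "monoid_algebra N :: ('k, 'c \<Rightarrow>\<^sub>0 'k) module"
  show "push_forward p (f \<otimes>\<^bsub>?A\<^esub> g) = push_forward p f \<otimes>\<^bsub>?B\<^esub> push_forward p g"
    if "f \<in> carrier ?A" "g \<in> carrier ?A" for f g
  proof -
    have keys: "Poly_Mapping.keys f \<subseteq> carrier M" "Poly_Mapping.keys g \<subseteq> carrier M"
      using that by (auto simp: monoid_algebra_simps)
    show ?thesis
      using keys(1)
    proof (induction rule: poly_mapping_keys_induct)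
      case (single x c)
      show ?case
        using keys(2)
        by (induction rule: poly_mapping_keys_induct)
           (use single p in \<open>simp_all add: hom_mult push_forward_add monoid_algebra_mult_add_right\<close>)
    qed (simp_all add: push_forward_add monoid_algebra_mult_add_left)
  qed
  show "push_forward p f \<in> carrier ?B" if "f \<in> carrier ?A" for f
    using that keys_push_forward[of p f] hom_in_carrier[OF p(1)]
    by (fastforce simp: monoid_algebra_simps)
qed (use M N p in \<open>simp_all add: monoid_algebra_ring monoid_algebra_simps push_forward_add\<close>)

lemma push_forward_surj:
  fixes M :: "('a, 'b) monoid_scheme" and N :: "('c, 'd) monoid_scheme"
  assumes "p ` carrier M = carrier N"
  shows "push_forward p ` carrier (monoid_algebra M :: ('k::field, 'a \<Rightarrow>\<^sub>0 'k) module)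
    = carrier (monoid_algebra N)" (is "push_forward p ` carrier ?A = carrier ?B")
proof
  show "push_forward p ` carrier ?A \<subseteq> carrier ?B"
    using assms keys_push_forward[of p] by (fastforce simp: monoid_algebra_simps)
  show "carrier ?B \<subseteq> push_forward p ` carrier ?A"
  proof
    fix g :: "'c \<Rightarrow>\<^sub>0 'k"
    assume "g \<in> carrier ?B"
    then have g: "Poly_Mapping.keys g \<subseteq> p ` carrier M"
      using assms by (simp add: monoid_algebra_simps)
    let ?s = "inv_into (carrier M) p"
    have "push_forward p (push_forward ?s g) = g"
      unfolding push_forward_push_forward
      by (rule push_forward_ident) (use g in \<open>auto intro: f_inv_into_f\<close>)
    moreover have "push_forward ?s g \<in> carrier ?A"
      using keys_push_forward[of ?s g] g inv_into_into[of _ p "carrier M"]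
      by (fastforce simp: monoid_algebra_simps)
    ultimately show "g \<in> push_forward p ` carrier ?A"
      by (metis image_eqI)
  qed
qed

text \<open>
  Ideals of a ring record are closed under ring multiplication only.  Scalars still act on them,
  because a scalar \<open>c\<close> is the ring element \<open>c \<cdot> 1\<close>.
\<close>

lemma monoid_algebra_ideal_scaled_difference:
  assumes M: "monoid M" and I: "ideal I (monoid_algebra M)"
    and mem: "Poly_Mapping.single x 1 - Poly_Mapping.single y 1 \<in> I"
    and "x \<in> carrier M" "y \<in> carrier M"
  shows "Poly_Mapping.single x c - Poly_Mapping.single y (c :: 'k::field) \<in> I"
proof -
  interpret monoid M by fact
  let ?A = "monoid_algebra M :: ('k, 'a \<Rightarrow>\<^sub>0 'k) module"
  \<comment> \<open>The product is known to be additive, so the difference is written as a sum.\<close>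
  have eq: "Poly_Mapping.single x d - Poly_Mapping.single y d
      = Poly_Mapping.single x d + Poly_Mapping.single y (- d)" for d :: 'k
    by (simp add: single_uminus)
  have "Poly_Mapping.single \<one>\<^bsub>M\<^esub> c \<otimes>\<^bsub>?A\<^esub>
      (Poly_Mapping.single x 1 - Poly_Mapping.single y 1) \<in> I"
    using ideal.I_l_closed[OF I mem] by (simp add: monoid_algebra_simps)
  then show ?thesis
    unfolding eq using assms(4,5) by (simp add: monoid_algebra_mult_add_right)
qed

text \<open>
  Choose a representative \<open>s x\<close> in the fibre of \<open>p\<close> through each \<open>x\<close>.  Modulo the differences
  \<open>x - s x\<close>, every \<open>f\<close> agrees with its push forward along \<open>s\<close>.  Since \<open>s\<close> factors through \<open>p\<close>, that
  push forward vanishes as soon as the push forward along \<open>p\<close> does.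
\<close>

lemma push_forward_kernel:
  fixes M :: "('a, 'b) monoid_scheme" and I :: "('a \<Rightarrow>\<^sub>0 'k::field) set"
  assumes M: "monoid M" and I: "ideal I (monoid_algebra M)"
    and diff: "\<And>x y. x \<in> carrier M \<Longrightarrow> y \<in> carrier M \<Longrightarrow> p x = p y \<Longrightarrow>
        Poly_Mapping.single x 1 - Poly_Mapping.single y 1 \<in> I"
    and f: "f \<in> carrier (monoid_algebra M)" "push_forward p f = 0"
  shows "f \<in> I"
proof -
  let ?A = "monoid_algebra M :: ('k, 'a \<Rightarrow>\<^sub>0 'k) module"
  interpret I: ideal I ?A by fact
  let ?s = "\<lambda>x. inv_into (carrier M) p (p x)"
  have add: "g + h \<in> I" if "g \<in> I" "h \<in> I" for g h
    using additive_subgroup.a_closed[OF I.additive_subgroup_axioms that] by (simp add: monoid_algebra_simps)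
  have keys: "Poly_Mapping.keys f \<subseteq> carrier M"
    using f by (simp add: monoid_algebra_simps)
  have "f - push_forward ?s f \<in> I"
    using keys
  proof (induction rule: poly_mapping_keys_induct)
    case zero
    show ?case
      using additive_subgroup.zero_closed[OF I.additive_subgroup_axioms] by (simp add: monoid_algebra_simps)
  next
    case (single x c)
    then have s: "?s x \<in> carrier M" "p (?s x) = p x"
      by (auto intro: inv_into_into f_inv_into_f)
    show ?case
      using monoid_algebra_ideal_scaled_difference[OF M I diff] single s by simp
  next
    case (add f g)
    have "f + g - push_forward ?s (f + g) = (f - push_forward ?s f) + (g - push_forward ?s g)"
      by (simp add: push_forward_add)
    then show ?case
      using add \<open>\<And>g h. g \<in> I \<Longrightarrow> h \<in> I \<Longrightarrow> g + h \<in> I\<close> by metis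
  qed
  moreover have "push_forward ?s f = 0"
    using f(2) push_forward_push_forward[of "inv_into (carrier M) p" p f] by simp
  ultimately show ?thesis
    by simp
qed

text \<open>
  The first isomorphism theorem for rings, with scalars added: \<open>h\<close> is constant on each coset, so it
  sends the union of cosets that defines a scalar multiple to the scalar multiple of that constant.
\<close>

lemma quotient_algebra_iso:
  fixes A :: "('k, 'a) module" and B :: "('k, 'b) module"
  assumes hom: "ring_hom_ring A B h" and surj: "h ` carrier A = carrier B"
    and I: "a_kernel A B h = I"
    and smult_closed: "\<And>c x. x \<in> carrier A \<Longrightarrow> c \<odot>\<^bsub>A\<^esub> x \<in> carrier A"
    and smult: "\<And>c x. x \<in> carrier A \<Longrightarrow> h (c \<odot>\<^bsub>A\<^esub> x) = c \<odot>\<^bsub>B\<^esub> h x"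
  shows "(\<lambda>X. the_elem (h ` X)) \<in> algebra_iso (quotient_algebra A I) B"
proof -
  interpret h: ring_hom_ring A B h by fact
  interpret ideal "I" A
    using h.kernel_is_ideal unfolding I .
  have I_iff: "i \<in> I \<longleftrightarrow> i \<in> carrier A \<and> h i = \<zero>\<^bsub>B\<^esub>" for i
    unfolding I[symmetric] a_kernel_def' by blast
  let ?Q = "quotient_algebra A I"
  have Q: "carrier ?Q = carrier (A Quot I)" "mult ?Q = mult (A Quot I)" "one ?Q = one (A Quot I)"
    "add ?Q = add (A Quot I)" "smult ?Q = (\<lambda>c C. \<Union>x\<in>C. I +>\<^bsub>A\<^esub> (c \<odot>\<^bsub>A\<^esub> x))"
    by (simp_all add: quotient_algebra_def ring.defs module.defs)
  have "the_elem (h ` (c \<odot>\<^bsub>?Q\<^esub> C)) = c \<odot>\<^bsub>B\<^esub> the_elem (h ` C)" if "C \<in> carrier ?Q" for c C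
  proof -
    have "C \<in> carrier (A Quot a_kernel A B h)"
      using that unfolding Q(1) I .
    from h.quot_mem[OF this] obtain r where C: "r \<in> carrier A" "C = I +>\<^bsub>A\<^esub> r"
      unfolding I by (elim bexE)
    have r: "r \<in> C"
      using C a_rcos_self by simp
    have mem: "y \<in> carrier A \<and> h y = h x" if "y \<in> I +>\<^bsub>A\<^esub> x" "x \<in> carrier A" for x y
    proof -
      obtain i where i: "i \<in> I" "y = i \<oplus>\<^bsub>A\<^esub> x"
        using \<open>y \<in> I +>\<^bsub>A\<^esub> x\<close> by (auto simp: a_r_coset_def')
      then have "i \<in> carrier A" "h i = \<zero>\<^bsub>B\<^esub>"
        using I_iff by blast+
      then show ?thesis
        using i(2) that(2) by simp
    qed
    have "h y = c \<odot>\<^bsub>B\<^esub> h r" if "y \<in> c \<odot>\<^bsub>?Q\<^esub> C" for y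
    proof -
      obtain x where x: "x \<in> C" "y \<in> I +>\<^bsub>A\<^esub> (c \<odot>\<^bsub>A\<^esub> x)"
        using \<open>y \<in> c \<odot>\<^bsub>?Q\<^esub> C\<close> unfolding Q(5) by blast
      then show ?thesis
        using mem[of x r] mem[of y "c \<odot>\<^bsub>A\<^esub> x"] C smult smult_closed by metis
    qed
    moreover have "c \<odot>\<^bsub>A\<^esub> r \<in> c \<odot>\<^bsub>?Q\<^esub> C"
      using a_rcos_self[OF smult_closed[OF C(1)]] r unfolding Q(5) by blast
    ultimately have "h ` (c \<odot>\<^bsub>?Q\<^esub> C) = {c \<odot>\<^bsub>B\<^esub> h r}"
      by auto
    moreover have "the_elem (h ` C) = h r"
      using h.the_elem_simp[OF C(1)] unfolding I C(2) .
    ultimately show ?thesis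
      by (simp only: the_elem_eq)
  qed
  moreover have "(\<lambda>X. the_elem (h ` X)) \<in> ring_iso ?Q B"
    using h.FactRing_iso_set[OF surj] unfolding I ring_iso_def ring_hom_def Q .
  ultimately show ?thesis
    by (simp add: algebra_iso_def)
qed

section \<open>Quadratic presentations from moves on words\<close>

definition word_product :: "('g, 'b) monoid_scheme \<Rightarrow> 'g list \<Rightarrow> 'g" where
  "word_product N w = foldr (mult N) w \<one>\<^bsub>N\<^esub>"

definition quadratic_move :: "('g, 'b) monoid_scheme \<Rightarrow> 'g set \<Rightarrow> 'g list \<Rightarrow> 'g list \<Rightarrow> bool" where
  "quadratic_move N G w w' \<longleftrightarrow> (\<exists>u v a b c d. u \<in> lists G \<and> v \<in> lists G \<and>
     a \<in> G \<and> b \<in> G \<and> c \<in> G \<and> d \<in> G \<and>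
     a \<otimes>\<^bsub>N\<^esub> b = c \<otimes>\<^bsub>N\<^esub> d \<and> w = u @ [a, b] @ v \<and> w' = u @ [c, d] @ v)"

lemma word_monoid: "monoid (word_monoid G)"
  by (rule monoidI) (auto simp: word_monoid_def)

lemma word_product_simps [simp]:
  "word_product N [] = \<one>\<^bsub>N\<^esub>"
  "word_product N (g # w) = g \<otimes>\<^bsub>N\<^esub> word_product N w"
  by (simp_all add: word_product_def)

lemma word_product_closed:
  assumes "monoid N" "G \<subseteq> carrier N" "w \<in> lists G"
  shows "word_product N w \<in> carrier N"
  using assms(3) by (induction w) (use assms(1,2) in \<open>auto intro: monoid.m_closed monoid.one_closed\<close>)

lemma word_product_append:
  assumes "monoid N" "G \<subseteq> carrier N" "u \<in> lists G" "v \<in> lists G"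
  shows "word_product N (u @ v) = word_product N u \<otimes>\<^bsub>N\<^esub> word_product N v"
  using assms(3)
proof (induction u)
  case Nil
  then show ?case
    using assms word_product_closed[of N G v] by (simp add: monoid.l_one)
next
  case (Cons g u)
  then show ?case
    using assms word_product_closed[of N G]
    by (auto simp: monoid.m_assoc subset_iff)
qed

lemma tensor_algebra_simps:
  "carrier (tensor_algebra G) = {f. Poly_Mapping.keys f \<subseteq> lists G}"
  "zero (tensor_algebra G) = 0"
  "add (tensor_algebra G) = (+)"
  "smult (tensor_algebra G) = (\<lambda>c f. Poly_Mapping.map ((*) c) f)"
  by (simp_all add: tensor_algebra_def monoid_algebra_simps word_monoid_def)

text \<open>
  A move in the context \<open>u\<close>, \<open>v\<close> changes a word by a relation multiplied by \<open>u\<close> on the left and by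
  \<open>v\<close> on the right; along a chain of moves the differences telescope.
\<close>

lemma quadratic_moves_in_ideal:
  fixes I :: "('g list \<Rightarrow>\<^sub>0 'k::field) set"
  assumes I: "ideal I (tensor_algebra G)"
    and relations: "\<And>a b c d. a \<in> G \<Longrightarrow> b \<in> G \<Longrightarrow> c \<in> G \<Longrightarrow> d \<in> G \<Longrightarrow>
      a \<otimes>\<^bsub>N\<^esub> b = c \<otimes>\<^bsub>N\<^esub> d \<Longrightarrow> Poly_Mapping.single [a, b] 1 - Poly_Mapping.single [c, d] 1 \<in> I"
    and "(quadratic_move N G)\<^sup>*\<^sup>* w w'"
  shows "Poly_Mapping.single w 1 - Poly_Mapping.single w' 1 \<in> I"
  using assms(3)
proof induction
  case base
  show ?case
    using additive_subgroup.zero_closed[OF ideal.axioms(1)[OF I]] by (simp add: tensor_algebra_simps)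
next
  case (step y z)
  let ?T = "tensor_algebra G :: ('k, 'g list \<Rightarrow>\<^sub>0 'k) module"
  obtain u v a b c d where uv: "u \<in> lists G" "v \<in> lists G" and
    abcd: "a \<in> G" "b \<in> G" "c \<in> G" "d \<in> G" "a \<otimes>\<^bsub>N\<^esub> b = c \<otimes>\<^bsub>N\<^esub> d"
    and yz: "y = u @ [a, b] @ v" "z = u @ [c, d] @ v"
    using step.hyps(2) unfolding quadratic_move_def by blast
  let ?x = "Poly_Mapping.single [a, b] 1 + Poly_Mapping.single [c, d] (- 1 :: 'k)"
  let ?u = "Poly_Mapping.single u (1 :: 'k)" and ?v = "Poly_Mapping.single v (1 :: 'k)"
  have x: "?x \<in> I"
    using relations[OF abcd] by (simp add: single_uminus)
  have carrier: "?u \<in> carrier ?T" "?v \<in> carrier ?T"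
    using uv by (simp_all add: tensor_algebra_simps)
  have "?u \<otimes>\<^bsub>?T\<^esub> ?x \<otimes>\<^bsub>?T\<^esub> ?v \<in> I"
    by (intro ideal.I_r_closed[OF I] ideal.I_l_closed[OF I] x carrier)
  also have "?u \<otimes>\<^bsub>?T\<^esub> ?x \<otimes>\<^bsub>?T\<^esub> ?v = Poly_Mapping.single y 1 + Poly_Mapping.single z (- 1)"
    by (simp add: tensor_algebra_def word_monoid_def yz
        monoid_algebra_mult_add_left monoid_algebra_mult_add_right)
  finally have "Poly_Mapping.single y 1 - Poly_Mapping.single z 1 \<in> I"
    by (simp add: single_uminus)
  from additive_subgroup.a_closed[OF ideal.axioms(1)[OF I] step.IH this] show ?case
    by (simp add: tensor_algebra_simps)
qed

text \<open>
  This turns being quadratic into combinatorics.  The relations are the differences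
  \<open>a \<otimes> b - c \<otimes> d\<close> over all pairs of generators with equal product.  The ideal that they
  generate is contained in the kernel of the evaluation of words, and the kernel is spanned by the
  differences of words with equal product, which lie in the ideal once moves connect such words.
\<close>

theorem quadratic_presentation_of_connected_words:
  fixes N :: "('g, 'b) monoid_scheme"
  assumes N: "monoid N" and G: "finite G" "G \<subseteq> carrier N"
    and generates: "carrier N \<subseteq> word_product N ` lists G"
    and connected: "\<And>w w'. w \<in> lists G \<Longrightarrow> w' \<in> lists G \<Longrightarrow>
      word_product N w = word_product N w' \<Longrightarrow> (quadratic_move N G)\<^sup>*\<^sup>* w w'"
  shows "quadratic_presentation (monoid_algebra N :: ('k::field, 'g \<Rightarrow>\<^sub>0 'k) module) G
    (\<lambda>g. Poly_Mapping.single g 1)"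
proof -
  let ?p = "word_product N"
  let ?h = "push_forward ?p :: ('g list \<Rightarrow>\<^sub>0 'k) \<Rightarrow> _"
  let ?T = "tensor_algebra G :: ('k, 'g list \<Rightarrow>\<^sub>0 'k) module"
  let ?B = "monoid_algebra N :: ('k, 'g \<Rightarrow>\<^sub>0 'k) module"
  define R :: "('g list \<Rightarrow>\<^sub>0 'k) set" where
    "R = {Poly_Mapping.single [a, b] 1 - Poly_Mapping.single [c, d] 1 | a b c d.
      a \<in> G \<and> b \<in> G \<and> c \<in> G \<and> d \<in> G \<and> a \<otimes>\<^bsub>N\<^esub> b = c \<otimes>\<^bsub>N\<^esub> d}"
  define I where "I = Idl\<^bsub>?T\<^esub> R"
  interpret N: monoid N by fact
  interpret T: ring ?T
    unfolding tensor_algebra_def by (rule monoid_algebra_ring[OF word_monoid])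
  have p: "?p \<in> hom (word_monoid G) N"
    using word_product_closed[OF N G(2)] word_product_append[OF N G(2)]
    by (auto simp: hom_def word_monoid_def)
  interpret h: ring_hom_ring ?T ?B ?h
    unfolding tensor_algebra_def
    by (rule push_forward_ring_hom[OF word_monoid N p]) (simp add: word_monoid_def)
  have R_degree: "R \<subseteq> tensor_power G 2"
    using keys_diff by (fastforce simp: R_def tensor_power_def tensor_algebra_simps split: if_splits)
  then have R_carrier: "R \<subseteq> carrier ?T"
    by (auto simp: tensor_power_def)
  interpret I: ideal I ?T
    unfolding I_def by (rule T.genideal_ideal[OF R_carrier])
  have h_single: "?h (Poly_Mapping.single a 1 - Poly_Mapping.single b 1)
      = Poly_Mapping.single (?p a) 1 - Poly_Mapping.single (?p b) 1" for a b
    by (simp add: push_forward_diff)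
  have kernel_iff: "f \<in> a_kernel ?T ?B ?h \<longleftrightarrow> f \<in> carrier ?T \<and> ?h f = 0" for f
    unfolding a_kernel_def' monoid_algebra_simps(3) by blast
  have "R \<subseteq> a_kernel ?T ?B ?h"
  proof
    fix f assume f: "f \<in> R"
    then obtain a b c d where abcd: "a \<in> G" "b \<in> G" "c \<in> G" "d \<in> G"
      "a \<otimes>\<^bsub>N\<^esub> b = c \<otimes>\<^bsub>N\<^esub> d" "f = Poly_Mapping.single [a, b] 1 - Poly_Mapping.single [c, d] 1"
      by (auto simp: R_def)
    then have "?h f = 0"
      using G(2) by (simp add: h_single subset_iff)
    then show "f \<in> a_kernel ?T ?B ?h"
      using f R_carrier unfolding kernel_iff by blast
  qed
  then have I_kernel: "I \<subseteq> a_kernel ?T ?B ?h"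
    unfolding I_def by (rule T.genideal_minimal[OF h.kernel_is_ideal])
  have diff: "Poly_Mapping.single w 1 - Poly_Mapping.single w' 1 \<in> I"
    if "(quadratic_move N G)\<^sup>*\<^sup>* w w'" for w w'
  proof (rule quadratic_moves_in_ideal[OF I.ideal_axioms _ that])
    show "Poly_Mapping.single [a, b] 1 - Poly_Mapping.single [c, d] 1 \<in> I"
      if "a \<in> G" "b \<in> G" "c \<in> G" "d \<in> G" "a \<otimes>\<^bsub>N\<^esub> b = c \<otimes>\<^bsub>N\<^esub> d" for a b c d
    proof -
      have "Poly_Mapping.single [a, b] 1 - Poly_Mapping.single [c, d] 1 \<in> R"
        unfolding R_def using that by blast
      then show ?thesis
        using T.genideal_self[OF R_carrier] unfolding I_def by blast
    qed
  qed
  have kernel: "a_kernel ?T ?B ?h = I"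
  proof
    show "a_kernel ?T ?B ?h \<subseteq> I"
    proof
      fix f assume "f \<in> a_kernel ?T ?B ?h"
      then have f: "f \<in> carrier (monoid_algebra (word_monoid G))" "?h f = 0"
        using kernel_iff unfolding tensor_algebra_def by blast+
      show "f \<in> I"
      proof (rule push_forward_kernel[OF word_monoid _ _ f])
        show "ideal I (monoid_algebra (word_monoid G))"
          using I.ideal_axioms unfolding tensor_algebra_def .
        show "Poly_Mapping.single w 1 - Poly_Mapping.single w' 1 \<in> I"
          if "w \<in> carrier (word_monoid G)" "w' \<in> carrier (word_monoid G)" "?p w = ?p w'" for w w'
          using that unfolding word_monoid_def by (intro diff connected) simp_all
      qed
    qed
  qed (rule I_kernel)
  have surj: "?p ` carrier (word_monoid G) = carrier N"
    using generates word_product_closed[OF N G(2)] unfolding word_monoid_def by force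
  have iso: "(\<lambda>X. the_elem (?h ` X)) \<in> algebra_iso (quotient_algebra ?T I) ?B"
  proof (rule quotient_algebra_iso[OF h.ring_hom_ring_axioms _ kernel])
    show "?h ` carrier ?T = carrier ?B"
      unfolding tensor_algebra_def by (rule push_forward_surj[OF surj])
    show "c \<odot>\<^bsub>?T\<^esub> f \<in> carrier ?T" if "f \<in> carrier ?T" for c f
      using that keys_scale_subset[of c f] unfolding tensor_algebra_simps by blast
    show "?h (c \<odot>\<^bsub>?T\<^esub> f) = c \<odot>\<^bsub>?B\<^esub> ?h f" for c f
      unfolding tensor_algebra_simps monoid_algebra_simps by (rule push_forward_scale)
  qed
  have generators: "the_elem (?h ` (I +>\<^bsub>?T\<^esub> Poly_Mapping.single [g] 1)) = Poly_Mapping.single g 1"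
    if "g \<in> G" for g
  proof -
    have "Poly_Mapping.single [g] 1 \<in> carrier ?T"
      using that by (simp add: tensor_algebra_simps)
    moreover have "g \<otimes>\<^bsub>N\<^esub> \<one>\<^bsub>N\<^esub> = g"
      using that G(2) by (intro N.r_one) blast
    ultimately show ?thesis
      using h.the_elem_simp[of "Poly_Mapping.single [g] 1"] unfolding kernel by simp
  qed
  show ?thesis
    unfolding quadratic_presentation_def Let_def
    using G(1) R_degree generators iso unfolding I_def
    by (intro conjI exI[of _ R] bexI[of _ "\<lambda>X. the_elem (?h ` X)"] ballI) assumption+
qed

section \<open>The monoid of semistandard tableaux\<close>

definition row_below :: "nat list \<Rightarrow> nat list \<Rightarrow> bool" where
  "row_below r s \<longleftrightarrow> length s \<le> length r \<and> (\<forall>j<length s. r ! j < s ! j)"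

text \<open>
  Sorting a concatenation of rows mixes up positions, but the number of entries below a given bound
  just adds up.  Hence the column condition is restated by counting: if the \<open>j\<close>-th entry of \<open>s\<close> is
  \<open>a\<close>, then \<open>s\<close> has more than \<open>j\<close> entries up to \<open>a\<close>, so \<open>r\<close> has more than \<open>j\<close> entries less than
  \<open>a\<close>.
\<close>

lemma row_below_iff_count:
  assumes "sorted r" "sorted s"
  shows "row_below r s \<longleftrightarrow>
    (\<forall>a. length (filter (\<lambda>x. x \<le> a) s) \<le> length (filter (\<lambda>x. x < a) r))"
proof
  assume *: "row_below r s"
  show "\<forall>a. length (filter (\<lambda>x. x \<le> a) s) \<le> length (filter (\<lambda>x. x < a) r)"
  proof
    fix a
    have "{j. j < length s \<and> s ! j \<le> a} \<subseteq> {j. j < length r \<and> r ! j < a}"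
      using * unfolding row_below_def by (auto intro: less_le_trans)
    then show "length (filter (\<lambda>x. x \<le> a) s) \<le> length (filter (\<lambda>x. x < a) r)"
      unfolding length_filter_conv_card by (intro card_mono) auto
  qed
next
  assume *: "\<forall>a. length (filter (\<lambda>x. x \<le> a) s) \<le> length (filter (\<lambda>x. x < a) r)"
  have *: "j < length r \<and> r ! j < s ! j" if j: "j < length s" for j
  proof (rule ccontr)
    assume not: "\<not> ?thesis"
    \<comment> \<open>As \<open>r\<close> is sorted, from position \<open>j\<close> on all of its entries are at least \<open>s ! j\<close>.\<close>
    have "{i. i < length r \<and> r ! i < s ! j} \<subseteq> {..<j}"
      using not assms(1) by (auto simp: sorted_iff_nth_mono) (meson le_less_trans linorder_not_less order_trans)
    then have "length (filter (\<lambda>x. x < s ! j) r) \<le> j"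
      unfolding length_filter_conv_card using card_mono[of "{..<j}"] by fastforce
    moreover have "{..j} \<subseteq> {i. i < length s \<and> s ! i \<le> s ! j}"
      using assms(2) j by (auto simp: sorted_iff_nth_mono)
    then have "Suc j \<le> length (filter (\<lambda>x. x \<le> s ! j) s)"
      unfolding length_filter_conv_card using card_mono[of "{i. i < length s \<and> s ! i \<le> s ! j}" "{..j}"] by simp
    ultimately show False
      using *[rule_format, of "s ! j"] by linarith
  qed
  show "row_below r s"
    unfolding row_below_def
    by (cases "length s") (use * in \<open>fastforce simp: Suc_le_eq\<close>)+
qed

lemma row_below_merge:
  assumes "row_below r s" "row_below r' s'" "sorted r" "sorted s" "sorted r'" "sorted s'"
  shows "row_below (sort (r @ r')) (sort (s @ s'))"
proof -
  have "length (filter P (sort xs)) = length (filter P xs)" for P and xs :: "nat list"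
    by (metis mset_filter mset_sort size_mset)
  then show ?thesis
    using assms by (simp add: row_below_iff_count add_mono)
qed

lemma row_Nil [simp]: "row [] i = []"
  by (simp add: row_def)

lemma row_Cons: "row (r # T) i = (case i of 0 \<Rightarrow> r | Suc i \<Rightarrow> row T i)"
  by (auto simp: row_def split: nat.splits)

lemma row_eq_Nil_iff: "[] \<notin> set T \<Longrightarrow> row T i = [] \<longleftrightarrow> length T \<le> i"
  by (auto simp: row_def dest: nth_mem)

text \<open>
  Rows beyond the last one read as empty, so without actual empty rows the number of rows can be
  recovered from the row function.
\<close>

lemma tableau_eqI:
  assumes "[] \<notin> set T" "[] \<notin> set T'" "\<And>i. row T i = row T' i"
  shows "T = T'"
proof -
  have "length T \<le> i \<longleftrightarrow> length T' \<le> i" for i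
    using assms row_eq_Nil_iff by metis
  then have "length T = length T'"
    by (metis order_antisym order_refl)
  then show ?thesis
  proof (rule nth_equalityI)
    show "T ! i = T' ! i" if "i < length T" for i
      using assms(3)[of i] that \<open>length T = length T'\<close> by (simp add: row_def)
  qed
qed

text \<open>
  Reading a missing row as empty removes all index bounds, since an empty row may stand below any
  row.
\<close>

lemma SSYT_iff_rows:
  "T \<in> SSYT n m \<longleftrightarrow> [] \<notin> set T \<and> length T \<le> n \<and>
     (\<forall>i. sorted (row T i) \<and> set (row T i) \<subseteq> {1..m} \<and> row_below (row T i) (row T (Suc i)))"
proof -
  have partition: "is_partition (shape T) \<longleftrightarrow>
      [] \<notin> set T \<and> (\<forall>i. Suc i < length T \<longrightarrow> length (T ! Suc i) \<le> length (T ! i))"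
    by (auto simp: is_partition_def shape_def sorted_wrt_iff_nth_Suc_transp transp_on_def)
  have below: "(\<forall>i. row_below (row T i) (row T (Suc i))) \<longleftrightarrow>
      (\<forall>i. Suc i < length T \<longrightarrow> length (T ! Suc i) \<le> length (T ! i)) \<and>
      (\<forall>i j. Suc i < length T \<and> j < length (T ! Suc i) \<longrightarrow> T ! i ! j < T ! Suc i ! j)"
    by (auto simp: row_below_def row_def)
  have all_rows: "(\<forall>i. P (row T i)) \<longleftrightarrow> (\<forall>r\<in>set T. P r)" if "P []" for P
    using that by (auto simp: row_def all_set_conv_all_nth)
  have rows: "(\<forall>i. sorted (row T i) \<and> set (row T i) \<subseteq> {1..m}) \<longleftrightarrow>
      (\<forall>r\<in>set T. sorted r \<and> set r \<subseteq> {1..m})"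
    by (rule all_rows) simp
  have "(\<forall>i. sorted (row T i) \<and> set (row T i) \<subseteq> {1..m} \<and> row_below (row T i) (row T (Suc i))) \<longleftrightarrow>
      (\<forall>i. sorted (row T i) \<and> set (row T i) \<subseteq> {1..m}) \<and> (\<forall>i. row_below (row T i) (row T (Suc i)))"
    by blast
  moreover have "0 \<notin> set r" if "set r \<subseteq> {1..m}" for r :: "nat list"
    using that by auto
  ultimately show ?thesis
    unfolding SSYT_def is_ssyt_def mem_Collect_eq partition rows below by blast
qed

lemma row_star [simp]: "row (T \<star> T') i = sort (row T i @ row T' i)"
  by (auto simp: star_def row_def)

lemma SSYT_rows:
  assumes "T \<in> SSYT n m"
  shows "[] \<notin> set T" "length T \<le> n" "sorted (row T i)" "set (row T i) \<subseteq> {1..m}"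
    "row_below (row T i) (row T (Suc i))"
  using assms by (simp_all add: SSYT_iff_rows)

lemma Nil_notin_star:
  assumes "[] \<notin> set T" "[] \<notin> set T'"
  shows "[] \<notin> set (T \<star> T')"
proof -
  have "[] = sort xs \<longleftrightarrow> xs = []" for xs :: "nat list"
    by (metis set_empty set_sort)
  then show ?thesis
    using row_eq_Nil_iff[OF assms(1)] row_eq_Nil_iff[OF assms(2)] by (auto simp: star_def less_max_iff_disj)
qed

lemma star_closed:
  assumes "T \<in> SSYT n m" "T' \<in> SSYT n m"
  shows "T \<star> T' \<in> SSYT n m"
  unfolding SSYT_iff_rows row_star
proof (intro conjI allI)
  note rows = SSYT_rows[OF assms(1)] SSYT_rows[OF assms(2)]
  show "[] \<notin> set (T \<star> T')"
    by (intro Nil_notin_star rows)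
  show "length (T \<star> T') \<le> n"
    using rows(2,7) by (simp add: star_def)
  fix i
  show "sorted (sort (row T i @ row T' i))"
    by simp
  show "set (sort (row T i @ row T' i)) \<subseteq> {1..m}"
    using rows(4,9) by simp
  show "row_below (sort (row T i @ row T' i)) (sort (row T (Suc i) @ row T' (Suc i)))"
    by (intro row_below_merge rows)
qed

lemma ssyt_monoid: "monoid (ssyt_monoid n m)"
proof (rule monoidI)
  fix T T' T''
  assume "T \<in> carrier (ssyt_monoid n m)" "T' \<in> carrier (ssyt_monoid n m)"
    "T'' \<in> carrier (ssyt_monoid n m)"
  then show "T \<otimes>\<^bsub>ssyt_monoid n m\<^esub> T' \<otimes>\<^bsub>ssyt_monoid n m\<^esub> T''
      = T \<otimes>\<^bsub>ssyt_monoid n m\<^esub> (T' \<otimes>\<^bsub>ssyt_monoid n m\<^esub> T'')"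
    unfolding ssyt_monoid_def
    by (auto intro!: tableau_eqI properties_for_sort simp: Nil_notin_star SSYT_rows(1))
next
  fix T assume "T \<in> carrier (ssyt_monoid n m)"
  then show "\<one>\<^bsub>ssyt_monoid n m\<^esub> \<otimes>\<^bsub>ssyt_monoid n m\<^esub> T = T"
    "T \<otimes>\<^bsub>ssyt_monoid n m\<^esub> \<one>\<^bsub>ssyt_monoid n m\<^esub> = T"
    unfolding ssyt_monoid_def
    by (auto intro!: tableau_eqI sorted_sort_id simp: Nil_notin_star SSYT_rows(1,3))
next
  show "\<one>\<^bsub>ssyt_monoid n m\<^esub> \<in> carrier (ssyt_monoid n m)"
    by (simp add: ssyt_monoid_def SSYT_iff_rows row_below_def)
qed (auto simp: ssyt_monoid_def star_closed)

section \<open>The lattice of columns\<close>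

lemma one_column_tableaux_iff:
  "C \<in> one_column_tableaux n m \<longleftrightarrow> C \<noteq> [] \<and> length C \<le> n \<and>
     (\<forall>i<length C. length (C ! i) = 1 \<and> C ! i ! 0 \<in> {1..m}) \<and>
     (\<forall>i. Suc i < length C \<longrightarrow> C ! i ! 0 < C ! Suc i ! 0)"
  (is "_ \<longleftrightarrow> ?R")
proof
  assume "C \<in> one_column_tableaux n m"
  then have C: "C \<in> SSYT n m" and "C \<noteq> []" and hd: "length (hd C) = 1"
    by (auto simp: one_column_tableaux_def num_columns_def split: if_splits)
  have len: "length (row C i) \<le> 1" for i
  proof (induction i)
    case 0
    then show ?case
      using hd \<open>C \<noteq> []\<close> by (simp add: row_def hd_conv_nth)
  next
    case (Suc i)
    then show ?case
      using SSYT_rows(5)[OF C, of i] by (simp add: row_below_def)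
  qed
  have len1: "length (C ! i) = 1" if "i < length C" for i
    using len[of i] that SSYT_rows(1)[OF C] nth_mem[OF that]
    by (cases "C ! i") (auto simp: row_def)
  moreover have "C ! i ! 0 \<in> {1..m}" if "i < length C" for i
  proof -
    have "set (C ! i) \<subseteq> {1..m}"
      using SSYT_rows(4)[OF C, of i] that by (simp add: row_def)
    moreover have "C ! i ! 0 \<in> set (C ! i)"
      using len1[OF that] by simp
    ultimately show ?thesis
      by blast
  qed
  moreover have "C ! i ! 0 < C ! Suc i ! 0" if "Suc i < length C" for i
    using SSYT_rows(5)[OF C, of i] len1[OF that] that by (auto simp: row_def row_below_def)
  ultimately show ?R
    using \<open>C \<noteq> []\<close> SSYT_rows(2)[OF C] by simp
next
  assume R: ?R
  then have row: "row C i = (if i < length C then [C ! i ! 0] else [])" for i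
    by (auto simp: row_def length_Suc_conv)
  have "[] \<notin> set C"
    using R by (auto simp: in_set_conv_nth)
  then have "C \<in> SSYT n m"
    using R by (auto simp: SSYT_iff_rows row row_below_def)
  then show "C \<in> one_column_tableaux n m"
    using R by (simp add: one_column_tableaux_def num_columns_def hd_conv_nth)
qed

lemma finite_one_column_tableaux: "finite (one_column_tableaux n m)"
proof (rule finite_subset)
  show "one_column_tableaux n m \<subseteq> {C. set C \<subseteq> (\<lambda>a. [a]) ` {1..m} \<and> length C \<le> n}"
  proof
    fix C assume "C \<in> one_column_tableaux n m"
    then show "C \<in> {C. set C \<subseteq> (\<lambda>a. [a]) ` {1..m} \<and> length C \<le> n}"
      by (fastforce simp: one_column_tableaux_iff in_set_conv_nth length_Suc_conv)
  qed
  show "finite {C. set C \<subseteq> (\<lambda>a. [a]) ` {1..m} \<and> length C \<le> n}"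
    by (rule finite_lists_length_le) simp
qed

text \<open>
  A column is padded below its last entry with infinity.  Columns of different heights then become
  sequences of the same length, and the order of columns in a semistandard tableau becomes the
  componentwise order.
\<close>

definition entry :: "nat list list \<Rightarrow> nat \<Rightarrow> enat" where
  "entry C i = (if i < length C then enat (C ! i ! 0) else \<infinity>)"

text \<open>
  The componentwise minimum and maximum of two padded columns.  The minimum has the larger height and
  the maximum the smaller one, so both are nonempty columns and only finite values are stored.
\<close>

definition column_meet :: "nat list list \<Rightarrow> nat list list \<Rightarrow> nat list list" where
  "column_meet C D = map (\<lambda>i. [the_enat (min (entry C i) (entry D i))]) [0..<max (length C) (length D)]"

definition column_join :: "nat list list \<Rightarrow> nat list list \<Rightarrow> nat list list" where
  "column_join C D = map (\<lambda>i. [the_enat (max (entry C i) (entry D i))]) [0..<min (length C) (length D)]"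

lemma entry_column_meet [simp]: "entry (column_meet C D) i = min (entry C i) (entry D i)"
  by (auto simp: entry_def column_meet_def)

lemma entry_column_join [simp]: "entry (column_join C D) i = max (entry C i) (entry D i)"
  by (auto simp: entry_def column_join_def)

lemma column_eqI:
  assumes "C \<in> one_column_tableaux n m" "D \<in> one_column_tableaux n m"
    and entry: "\<And>i. entry C i = entry D i"
  shows "C = D"
proof -
  have "i < length C \<longleftrightarrow> i < length D" for i
    using entry[of i] by (auto simp: entry_def split: if_splits)
  then have len: "length C = length D"
    by (metis linorder_neqE_nat order_less_irrefl)
  show ?thesis
  proof (rule nth_equalityI[OF len])
    fix i assume i: "i < length C"
    have "length (C ! i) = 1" "length (D ! i) = 1"
      using assms(1,2) i len by (auto simp: one_column_tableaux_iff)
    moreover have "C ! i ! 0 = D ! i ! 0"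
      using entry[of i] i len by (simp add: entry_def)
    ultimately show "C ! i = D ! i"
      by (auto simp: length_Suc_conv)
  qed
qed

lemma column_meet_closed:
  assumes "C \<in> one_column_tableaux n m" "D \<in> one_column_tableaux n m"
  shows "column_meet C D \<in> one_column_tableaux n m"
  using assms unfolding one_column_tableaux_iff
  by (auto simp: column_meet_def entry_def min_def less_max_iff_disj)

lemma column_join_closed:
  assumes "C \<in> one_column_tableaux n m" "D \<in> one_column_tableaux n m"
  shows "column_join C D \<in> one_column_tableaux n m"
  using assms unfolding one_column_tableaux_iff
  by (auto simp: column_join_def entry_def max_def)

lemma mset_row_column:
  assumes "C \<in> one_column_tableaux n m"
  shows "mset (row C i) = (case entry C i of enat a \<Rightarrow> {#a#} | \<infinity> \<Rightarrow> {#})"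
  using assms by (auto simp: one_column_tableaux_iff row_def entry_def length_Suc_conv)

lemma one_column_SSYT: "one_column_tableaux n m \<subseteq> SSYT n m"
  by (auto simp: one_column_tableaux_def)

text \<open>
  In each row, minimum and maximum are the two given entries in some order.
\<close>

lemma column_meet_star_join:
  assumes "C \<in> one_column_tableaux n m" "D \<in> one_column_tableaux n m"
  shows "column_meet C D \<star> column_join C D = C \<star> D"
proof (rule tableau_eqI)
  note cols = assms column_meet_closed[OF assms] column_join_closed[OF assms]
  have nonempty: "[] \<notin> set X" if "X \<in> one_column_tableaux n m" for X
    using that one_column_SSYT SSYT_rows(1) by blast
  show "[] \<notin> set (column_meet C D \<star> column_join C D)" "[] \<notin> set (C \<star> D)"
    using nonempty cols by (simp_all add: Nil_notin_star)
  fix i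
  have "mset (row (column_meet C D) i @ row (column_join C D) i) = mset (row C i @ row D i)"
    unfolding mset_append mset_row_column[OF cols(1)] mset_row_column[OF cols(2)]
      mset_row_column[OF cols(3)] mset_row_column[OF cols(4)] entry_column_meet entry_column_join
    by (simp add: min_def max_def)
  then show "row (column_meet C D \<star> column_join C D) i = row (C \<star> D) i"
    by (auto intro: properties_for_sort)
qed

section \<open>Straightening words of columns\<close>

fun insert_column :: "nat list list \<Rightarrow> nat list list list \<Rightarrow> nat list list list" where
  "insert_column C [] = [C]"
| "insert_column C (D # w) = column_meet C D # insert_column (column_join C D) w"

definition straighten :: "nat list list list \<Rightarrow> nat list list list" where
  "straighten w = foldr insert_column w []"

lemma insert_column_closed:
  assumes "C \<in> one_column_tableaux n m" "w \<in> lists (one_column_tableaux n m)"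
  shows "insert_column C w \<in> lists (one_column_tableaux n m)"
  using assms by (induction C w rule: insert_column.induct) (auto simp: column_meet_closed column_join_closed)

lemma straighten_closed:
  assumes "w \<in> lists (one_column_tableaux n m)"
  shows "straighten w \<in> lists (one_column_tableaux n m)"
  using assms
proof (induction w)
  case (Cons C w)
  then show ?case
    using insert_column_closed[of C n m "straighten w"] by (simp add: straighten_def)
qed (simp add: straighten_def)

text \<open>
  Read in a single row, one pass of meets and joins is a pass of bubble sort: the smaller entry stays,
  the larger one is carried on, and into a sorted list this is insertion.
\<close>

lemma map_entry_insert_column:
  assumes "sorted (map (\<lambda>C. entry C i) w)"
  shows "map (\<lambda>C. entry C i) (insert_column C w) = insort (entry C i) (map (\<lambda>C. entry C i) w)"
  using assms
proof (induction C w rule: insert_column.induct)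
  case (2 C D w)
  \<comment> \<open>If the new entry is smaller than that of \<open>D\<close>, the pass carries the entry of \<open>D\<close> on, which stays first.\<close>
  have "insort (entry D i) (map (\<lambda>C. entry C i) w) = entry D i # map (\<lambda>C. entry C i) w"
    using 2(2) by (intro insort_is_Cons) auto
  then show ?case
    using 2 by (auto simp: min_def max_def)
qed simp

lemma map_entry_straighten:
  "map (\<lambda>C. entry C i) (straighten w) = sort (map (\<lambda>C. entry C i) w)"
proof (induction w)
  case (Cons C w)
  then show ?case
    by (simp add: straighten_def map_entry_insert_column)
qed (simp add: straighten_def)

text \<open>
  Each comparison in the pass replaces two adjacent columns by their meet and join, which have the
  same product.
\<close>

lemma quadratic_moves_insert_column:
  assumes "C \<in> one_column_tableaux n m" "u \<in> lists (one_column_tableaux n m)"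
    "w \<in> lists (one_column_tableaux n m)"
  shows "(quadratic_move (ssyt_monoid n m) (one_column_tableaux n m))\<^sup>*\<^sup>*
    (u @ C # w) (u @ insert_column C w)"
  using assms
proof (induction C w arbitrary: u rule: insert_column.induct)
  case (2 C D w)
  have "quadratic_move (ssyt_monoid n m) (one_column_tableaux n m)
      (u @ C # D # w) (u @ column_meet C D # column_join C D # w)"
    unfolding quadratic_move_def
    by (intro exI[of _ u] exI[of _ w] exI[of _ C] exI[of _ D] exI[of _ "column_meet C D"]
          exI[of _ "column_join C D"])
       (use 2 in \<open>auto simp: ssyt_monoid_def column_meet_star_join column_meet_closed column_join_closed\<close>)
  moreover have "(quadratic_move (ssyt_monoid n m) (one_column_tableaux n m))\<^sup>*\<^sup>*
      ((u @ [column_meet C D]) @ column_join C D # w) ((u @ [column_meet C D]) @ insert_column (column_join C D) w)"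
    by (rule 2(1)) (use 2 in \<open>auto simp: column_meet_closed column_join_closed\<close>)
  ultimately show ?case
    by (simp add: converse_rtranclp_into_rtranclp)
qed simp

lemma quadratic_moves_straighten:
  assumes "w \<in> lists (one_column_tableaux n m)" "u \<in> lists (one_column_tableaux n m)"
  shows "(quadratic_move (ssyt_monoid n m) (one_column_tableaux n m))\<^sup>*\<^sup>* (u @ w) (u @ straighten w)"
  using assms
proof (induction w arbitrary: u)
  case (Cons C w)
  have "(quadratic_move (ssyt_monoid n m) (one_column_tableaux n m))\<^sup>*\<^sup>*
      ((u @ [C]) @ w) ((u @ [C]) @ straighten w)"
    by (rule Cons.IH) (use Cons in auto)
  moreover have "(quadratic_move (ssyt_monoid n m) (one_column_tableaux n m))\<^sup>*\<^sup>*
      (u @ C # straighten w) (u @ insert_column C (straighten w))"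
    by (rule quadratic_moves_insert_column) (use Cons straighten_closed in auto)
  ultimately show ?case
    by (simp add: straighten_def)
qed (simp add: straighten_def)

text \<open>
  Row \<open>i\<close> of the product lists the finite entries in row \<open>i\<close> of all the columns; only the number of
  padding entries is not visible in it.
\<close>

lemma mset_entries_eq:
  assumes "w \<in> lists (one_column_tableaux n m)"
  shows "\<exists>k. mset (map (\<lambda>C. entry C i) w)
    = image_mset enat (mset (row (word_product (ssyt_monoid n m) w) i)) + replicate_mset k \<infinity>"
  using assms
proof (induction w)
  case Nil
  then show ?case
    by (simp add: ssyt_monoid_def exI[of _ 0])
next
  case (Cons C w)
  then obtain k where k: "mset (map (\<lambda>C. entry C i) w)
      = image_mset enat (mset (row (word_product (ssyt_monoid n m) w) i)) + replicate_mset k \<infinity>"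
    by auto
  have row: "mset (row (word_product (ssyt_monoid n m) (C # w)) i)
      = mset (row C i) + mset (row (word_product (ssyt_monoid n m) w) i)"
    by (simp add: ssyt_monoid_def)
  have C: "C \<in> one_column_tableaux n m"
    using Cons by simp
  show ?case
  proof (cases "entry C i")
    case (enat a)
    then show ?thesis
      unfolding row using k by (intro exI[of _ k]) (simp add: mset_row_column[OF C])
  next
    case infinity
    then show ?thesis
      unfolding row using k by (intro exI[of _ "Suc k"]) (simp add: mset_row_column[OF C])
  qed
qed

text \<open>
  Every column has an entry in the first row, so a product of columns remembers their number.  This
  fixes the number of padding entries in every other row.
\<close>

lemma length_first_row_product:
  assumes "w \<in> lists (one_column_tableaux n m)"
  shows "length (row (word_product (ssyt_monoid n m) w) 0) = length w"
  using assms
proof (induction w)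
  case (Cons C w)
  then have "length (row C 0) = 1"
    by (simp add: one_column_tableaux_iff row_def)
  moreover have "row (word_product (ssyt_monoid n m) (C # w)) 0
      = sort (row C 0 @ row (word_product (ssyt_monoid n m) w) 0)"
    by (simp add: ssyt_monoid_def)
  ultimately show ?case
    using Cons by simp
qed (simp add: ssyt_monoid_def)

text \<open>
  The straightened word has in row \<open>i\<close> the sorted list of all padded entries in row \<open>i\<close>, and the
  product together with the number of columns determines their multiset.
\<close>

lemma straighten_eq:
  assumes w: "w \<in> lists (one_column_tableaux n m)" and w': "w' \<in> lists (one_column_tableaux n m)"
    and eq: "word_product (ssyt_monoid n m) w = word_product (ssyt_monoid n m) w'"
  shows "straighten w = straighten w'"
proof -
  have len: "length w = length w'"
    using length_first_row_product[OF w] length_first_row_product[OF w'] eq by simp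
  have entries: "map (\<lambda>C. entry C i) (straighten w) = map (\<lambda>C. entry C i) (straighten w')" for i
  proof -
    obtain k k' where
      k: "mset (map (\<lambda>C. entry C i) w)
        = image_mset enat (mset (row (word_product (ssyt_monoid n m) w) i)) + replicate_mset k \<infinity>" and
      k': "mset (map (\<lambda>C. entry C i) w')
        = image_mset enat (mset (row (word_product (ssyt_monoid n m) w) i)) + replicate_mset k' \<infinity>"
      using mset_entries_eq[OF w] mset_entries_eq[OF w'] eq by metis
    have "k = k'"
      using arg_cong[OF k, of size] arg_cong[OF k', of size] len by simp
    then have "mset (map (\<lambda>C. entry C i) w) = mset (map (\<lambda>C. entry C i) w')"
      using k k' by metis
    then show ?thesis
      unfolding map_entry_straighten by (metis properties_for_sort sorted_sort mset_sort)
  qed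
  have len': "length (straighten w) = length (straighten w')"
    using entries[of 0] by (metis length_map)
  show ?thesis
  proof (rule nth_equalityI[OF len'])
    fix j assume j: "j < length (straighten w)"
    show "straighten w ! j = straighten w' ! j"
    proof (rule column_eqI)
      show "straighten w ! j \<in> one_column_tableaux n m" "straighten w' ! j \<in> one_column_tableaux n m"
        using straighten_closed[OF w] straighten_closed[OF w'] j len' by auto
      show "entry (straighten w ! j) i = entry (straighten w' ! j) i" for i
        using arg_cong[OF entries[of i], of "\<lambda>xs. xs ! j"] j len' by simp
    qed
  qed
qed

lemma quadratic_move_sym: "quadratic_move N G w w' \<Longrightarrow> quadratic_move N G w' w"
  unfolding quadratic_move_def by metis

lemma quadratic_moves_connect:
  assumes w: "w \<in> lists (one_column_tableaux n m)" and w': "w' \<in> lists (one_column_tableaux n m)"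
    and eq: "word_product (ssyt_monoid n m) w = word_product (ssyt_monoid n m) w'"
  shows "(quadratic_move (ssyt_monoid n m) (one_column_tableaux n m))\<^sup>*\<^sup>* w w'"
proof -
  have "symp (quadratic_move (ssyt_monoid n m) (one_column_tableaux n m))\<^sup>*\<^sup>*"
    by (intro symp_rtranclp sympI) (rule quadratic_move_sym)
  then show ?thesis
    using quadratic_moves_straighten[OF w, of "[]"] quadratic_moves_straighten[OF w', of "[]"]
      straighten_eq[OF w w' eq] by (simp add: symp_def) (meson rtranclp_trans)
qed

section \<open>Columns generate all tableaux\<close>

text \<open>
  Removing the first column of a tableau may exhaust its lower rows, which have to be dropped because
  a tableau has no empty rows.
\<close>

lemma row_takeWhile_nonempty:
  assumes "\<And>i. row T i = [] \<Longrightarrow> row T (Suc i) = []"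
  shows "row (takeWhile (\<lambda>r. r \<noteq> []) T) i = row T i"
  using assms
proof (induction T arbitrary: i)
  case (Cons r T)
  have step: "row T i = [] \<Longrightarrow> row T (Suc i) = []" for i
    using Cons.prems[of "Suc i"] by (simp add: row_Cons)
  show ?case
  proof (cases "r = []")
    case True
    have "row T i = []" for i
      by (induction i) (use Cons.prems[of 0] True step in \<open>auto simp: row_Cons\<close>)
    then show ?thesis
      using True by (simp add: row_Cons split: nat.split)
  next
    case False
    then show ?thesis
      using Cons.IH[OF step] by (simp add: row_Cons split: nat.split)
  qed
qed simp

lemma split_first_column:
  assumes T: "T \<in> SSYT n m" and "T \<noteq> []"
  obtains C T' where "C \<in> one_column_tableaux n m" "T' \<in> SSYT n m" "T = C \<star> T'"
    "length (row T' 0) < length (row T 0)"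
proof -
  let ?C = "map (\<lambda>r. [hd r]) T" and ?T' = "takeWhile (\<lambda>r. r \<noteq> []) (map tl T)"
  note rows = SSYT_rows[OF T]
  have row_C: "row ?C i = (if i < length T then [hd (row T i)] else [])" for i
    by (simp add: row_def)
  have row_tl: "row (map tl T) i = tl (row T i)" for i
    by (simp add: row_def)
  have row_T': "row ?T' i = tl (row T i)" for i
    unfolding row_tl[symmetric]
  proof (rule row_takeWhile_nonempty)
    fix i assume "row (map tl T) i = []"
    then show "row (map tl T) (Suc i) = []"
      using rows(5)[of i] unfolding row_tl row_below_def
      by (metis diff_le_mono le_zero_eq length_0_conv length_tl)
  qed
  have nonempty: "row T i \<noteq> []" if "i < length T" for i
    using that rows(1) by (simp add: row_eq_Nil_iff)
  have "?C \<in> one_column_tableaux n m"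
    unfolding one_column_tableaux_iff
  proof (intro conjI allI impI)
    fix i
    show "?C ! i ! 0 < ?C ! Suc i ! 0" if "Suc i < length ?C"
      using rows(5)[of i] nonempty[of i] nonempty[of "Suc i"] that
      by (simp add: row_below_def row_def hd_conv_nth)
    show "?C ! i ! 0 \<in> {1..m}" if "i < length ?C"
    proof -
      have "hd (row T i) \<in> set (row T i)"
        using nonempty that by simp
      then have "hd (row T i) \<in> {1..m}"
        using rows(4) by blast
      then show ?thesis
        using that by (simp add: row_def)
    qed
  qed (use rows(2) \<open>T \<noteq> []\<close> in auto)
  moreover have "?T' \<in> SSYT n m"
    unfolding SSYT_iff_rows row_T'
  proof (intro conjI allI)
    show "[] \<notin> set ?T'"
      by (auto dest: set_takeWhileD)
    show "length ?T' \<le> n"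
      using rows(2) length_takeWhile_le[of "\<lambda>r. r \<noteq> []" "map tl T"] by simp
    fix i
    show "sorted (tl (row T i))" "set (tl (row T i)) \<subseteq> {1..m}"
      using rows(3)[of i] rows(4)[of i] by (cases "row T i"; simp)+
    show "row_below (tl (row T i)) (tl (row T (Suc i)))"
      using rows(5)[of i] by (auto simp: row_below_def nth_tl)
  qed
  moreover have "T = ?C \<star> ?T'"
  proof (rule tableau_eqI)
    show "[] \<notin> set T" by (rule rows(1))
    show "[] \<notin> set (?C \<star> ?T')"
      by (rule Nil_notin_star) (auto dest: set_takeWhileD)
    show "row T i = row (?C \<star> ?T') i" for i
      using nonempty[of i] rows(3)[of i] unfolding row_star row_C row_T'
      by (cases "i < length T") (auto simp: sorted_sort_id row_def)
  qed
  moreover have "length (row ?T' 0) < length (row T 0)"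
    unfolding row_T' using nonempty[of 0] \<open>T \<noteq> []\<close> by simp
  ultimately show thesis
    using that by blast
qed

text \<open>
  A tableau is the product of its columns, split off from the left.
\<close>

lemma columns_generate:
  assumes "T \<in> SSYT n m"
  shows "T \<in> word_product (ssyt_monoid n m) ` lists (one_column_tableaux n m)"
  using assms
proof (induction "length (row T 0)" arbitrary: T rule: less_induct)
  case less
  show ?case
  proof (cases "T = []")
    case True
    then show ?thesis
      by (intro image_eqI[of _ _ "[]"]) (auto simp: ssyt_monoid_def)
  next
    case False
    then obtain C T' where *: "C \<in> one_column_tableaux n m" "T' \<in> SSYT n m" "T = C \<star> T'"
      "length (row T' 0) < length (row T 0)"
      using split_first_column less.prems by blast
    then obtain w where "w \<in> lists (one_column_tableaux n m)" "T' = word_product (ssyt_monoid n m) w"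
      using less.hyps by blast
    then show ?thesis
      using * by (intro image_eqI[of _ _ "C # w"]) (auto simp: ssyt_monoid_def)
  qed
qed

section \<open>The tableaux algebra is quadratic\<close>

theorem theorem2p13:
  fixes n m :: nat
  assumes "0 < n" and "n \<le> m"
  shows "quadratic_presentation
           (tableaux_algebra n m :: ('k::{alg_closed_field, field_char_0}, nat list list \<Rightarrow>\<^sub>0 'k) module)
           (one_column_tableaux n m)
           (\<lambda>C. Poly_Mapping.single C 1)"
  unfolding tableaux_algebra_def
proof (rule quadratic_presentation_of_connected_words)
  show "one_column_tableaux n m \<subseteq> carrier (ssyt_monoid n m)"
    using one_column_SSYT by (simp add: ssyt_monoid_def)
  show "carrier (ssyt_monoid n m) \<subseteq>
      word_product (ssyt_monoid n m) ` lists (one_column_tableaux n m)"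
    using columns_generate by (auto simp: ssyt_monoid_def)
qed (auto intro: ssyt_monoid finite_one_column_tableaux quadratic_moves_connect)

end
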